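(* Let $G^\sigma$ be a signed cycle of order $n\ge 3$, so that its girth $g(G^\sigma)$ equals $n$, and let $\lambda\in\mathbb{R}$. Then \[ m(G^\sigma,\lambda)=n-g(G^\sigma)+1 \] if and only if one of the following holds: (i) $G^\sigma$ is a balanced cycle and $\lambda=2$; (ii) $G^\sigma$ is a balanced cycle of even order and $\lambda=-2$; (iii) $G^\sigma$ is an unbalanced cycle of odd order and $\lambda=-2$.
   Context: A signed graph $G^\sigma=(G,\sigma)$ consists of a finite simple undirected graph $G=(V,E)$ and a sign function $\sigma:E\to\{+1,-1\}$; its order is $n=|V|$ and its girth $g(G^\sigma)$ is the length of a shortest cycle of $G$. A signed cycle of order $n$ is a signed graph whose underlying graph is the cycle $C_n$; it is balanced if the product of the signs of its edges is $+1$, and unbalanced otherwise. The adjacency matrix $A(G^\sigma)=[a^\sigma_{ij}]$ has $a^\sigma_{ij}=\sigma(v_iv_j)$ if $v_i$ and $v_j$ are adjacent and $a^\sigma_{ij}=0$ otherwise. $m(G^\sigma,\lambda)=n-\operatorname{rank}(\lambda I-A(G^\sigma))$ denotes the multiplicity of $\lambda$ as an eigenvalue of $A(G^\sigma)$ (equal to $0$ if $\lambda$ is not an eigenvalue). *)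

theory Defs
  imports "HOL-Analysis.Analysis"
begin

text \<open>
  The vertex set of a graph is the whole finite type \<open>'v\<close>, so the order is \<^term>\<open>CARD('v)\<close>;
  \<open>E\<close> is the set of edges, each a set of two vertices. Only the values of \<open>\<sigma>\<close> on \<open>E\<close> matter.
\<close>

definition simple_graph :: "'v::finite set set \<Rightarrow> bool" where
  "simple_graph E \<longleftrightarrow> (\<forall>e\<in>E. card e = 2)"

definition signed_graph :: "'v::finite set set \<Rightarrow> ('v set \<Rightarrow> int) \<Rightarrow> bool" where
  "signed_graph E \<sigma> \<longleftrightarrow> simple_graph E \<and> (\<forall>e\<in>E. \<sigma> e = 1 \<or> \<sigma> e = -1)"

definition cycle_edges :: "'v list \<Rightarrow> 'v set set" where
  "cycle_edges vs = {{vs ! i, vs ! (Suc i mod length vs)} | i. i < length vs}"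

definition cycle_in :: "'v set set \<Rightarrow> 'v list \<Rightarrow> bool" where
  "cycle_in E vs \<longleftrightarrow> 3 \<le> length vs \<and> distinct vs \<and> cycle_edges vs \<subseteq> E"

text \<open>For an acyclic graph the infimum is over the empty set and has the junk value \<open>0\<close>.\<close>

definition girth :: "'v set set \<Rightarrow> nat" where
  "girth E = Inf {length vs | vs. cycle_in E vs}"

text \<open>
  The list \<open>vs\<close> enumerates all vertices without repetition, i.e. it is an isomorphism from
  the standard cycle on \<open>{0..<n}\<close>, where \<open>n = length vs\<close>.
\<close>

definition cycle_graph :: "'v::finite set set \<Rightarrow> bool" where
  "cycle_graph E \<longleftrightarrow>
     (\<exists>vs. 3 \<le> length vs \<and> distinct vs \<and> set vs = UNIV \<and> E = cycle_edges vs)"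

definition signed_cycle :: "'v::finite set set \<Rightarrow> ('v set \<Rightarrow> int) \<Rightarrow> bool" where
  "signed_cycle E \<sigma> \<longleftrightarrow> signed_graph E \<sigma> \<and> cycle_graph E"

definition balanced_cycle :: "'v::finite set set \<Rightarrow> ('v set \<Rightarrow> int) \<Rightarrow> bool" where
  "balanced_cycle E \<sigma> \<longleftrightarrow> signed_cycle E \<sigma> \<and> (\<Prod>e\<in>E. \<sigma> e) = 1"

definition unbalanced_cycle :: "'v::finite set set \<Rightarrow> ('v set \<Rightarrow> int) \<Rightarrow> bool" where
  "unbalanced_cycle E \<sigma> \<longleftrightarrow> signed_cycle E \<sigma> \<and> (\<Prod>e\<in>E. \<sigma> e) \<noteq> 1"

definition adj_matrix :: "'v::finite set set \<Rightarrow> ('v set \<Rightarrow> int) \<Rightarrow> real ^ 'v ^ 'v" where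
  "adj_matrix E \<sigma> = (\<chi> u v. if {u, v} \<in> E then of_int (\<sigma> {u, v}) else 0)"

definition eig_mult :: "'v::finite set set \<Rightarrow> ('v set \<Rightarrow> int) \<Rightarrow> real \<Rightarrow> nat" where
  "eig_mult E \<sigma> \<mu> = CARD('v) - rank (\<mu> *\<^sub>R mat 1 - adj_matrix E \<sigma>)"

end

theory Submission
  imports Defs
begin

text \<open>
  Number the vertices \<open>v\<^sub>i\<close> cyclically and put \<open>s\<^sub>i = \<sigma>{v\<^sub>i, v\<^sub>i\<^sub>+\<^sub>1}\<close>. The signed rotation
  \<open>(Px)\<^sub>i = s\<^sub>i x\<^sub>i\<^sub>+\<^sub>1\<close> is orthogonal and commutes with \<open>A\<close>; in fact \<open>A = P + P\<^sup>-\<^sup>1\<close>, and \<open>P\<^sup>n = \<epsilon>I\<close>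
  for the product \<open>\<epsilon>\<close> of all signs. If the eigenspace of \<open>\<mu>\<close> is a line, then \<open>P\<close> acts on it as a real
  scalar \<open>c\<close>, so that \<open>c\<^sup>2 = 1\<close>, \<open>\<mu> = 2c\<close> and \<open>c\<^sup>n = \<epsilon>\<close>. Conversely, under these conditions
  \<open>\<parallel>Px - cx\<parallel>\<^sup>2 = c \<langle>x, (\<mu>I - A)x\<rangle>\<close> shows that every eigenvector satisfies \<open>Px = cx\<close> and is therefore
  determined by \<open>x\<^sub>0\<close>. The girth is \<open>n\<close> because a cycle in \<open>E\<close> is closed under \<open>v\<^sub>i \<mapsto> v\<^sub>i\<^sub>+\<^sub>1\<close>.
\<close>

section \<open>Linear algebra: null spaces and lines\<close>

lemma dim_null_space:
  fixes A :: "real ^ 'n ^ 'm"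
  shows "dim {x. A *v x = 0} = CARD('n) - rank A"
proof -
  \<comment> \<open>The entries of \<open>A *v y\<close> are inner products of \<open>y\<close> with
    the rows. Passing to the orthogonal complement of the row space turns the rank in
    \<open>eig_mult\<close> into the dimension of a kernel.\<close>
  have ker: "{x. A *v x = 0} = {y. \<forall>x\<in>span (rows A). orthogonal x y}"
  proof (intro Collect_cong iffI)
    fix y assume "A *v y = 0"
    then show "\<forall>x\<in>span (rows A). orthogonal x y"
      using orthogonal_nullspace_rowspace orthogonal_commute by blast
  next
    fix y assume "\<forall>x\<in>span (rows A). orthogonal x y"
    then have "row i A \<bullet> y = 0" for i
      by (simp add: orthogonal_def rows_def) (metis (mono_tags) mem_Collect_eq span_base)
    then show "A *v y = 0"
      by (simp add: vec_eq_iff matrix_vector_mult_def row_def inner_vec_def)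
  qed
  have "dim {y \<in> UNIV. \<forall>x\<in>span (rows A). orthogonal x y} + dim (span (rows A))
      = dim (UNIV :: (real^'n) set)"
    by (rule dim_subspace_orthogonal_to_vectors) auto
  then show ?thesis
    by (simp add: ker row_rank_def)
qed

lemma dim_1_imp_span_singleton:
  fixes S :: "'a::euclidean_space set"
  assumes "subspace S" "dim S = 1"
  obtains w where "w \<noteq> 0" "S = span {w}"
proof -
  obtain B where B: "B \<subseteq> S" "independent B" "S \<subseteq> span B" "card B = dim S"
    using basis_exists by blast
  then obtain w where w: "B = {w}"
    using assms(2) card_1_singletonE by metis
  have "w \<noteq> 0" using B(2) w dependent_zero by blast
  moreover have "S = span {w}" using B assms w by (simp add: span_subspace)
  ultimately show ?thesis using that by blast
qed

section \<open>Periodic vertex enumerations and lengths of cycles\<close>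

locale cycle_enumeration =
  fixes E :: "'v::finite set set" and V :: "nat \<Rightarrow> 'v" and n :: nat
  assumes V_eq_iff: "V i = V j \<longleftrightarrow> i mod n = j mod n"
    and V_surj: "surj V"
    and E_eq: "E = range (\<lambda>i. {V i, V (Suc i)})"
    and n_ge: "3 \<le> n"
begin

lemma V_add_n: "V (i + n) = V i"
  by (simp add: V_eq_iff)

lemma V_eqE:
  assumes "V i = V j" "i \<le> j"
  shows "n dvd j - i"
  using assms by (metis V_eq_iff mod_eq_dvd_iff_nat)

text \<open>This makes \<open>V i\<close> \<mapsto> \<open>V (Suc i)\<close> a well-defined
  injection on vertices, independent of the chosen index.\<close>

lemma V_Suc_eq_iff: "V (Suc i) = V (Suc j) \<longleftrightarrow> V i = V j"
proof
  have *: "V i = V j" if "V (Suc i) = V (Suc j)" "i \<le> j" for i j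
    using V_eqE[OF that(1)] that(2) mod_eq_dvd_iff_nat[of i j n]
    by (simp add: V_eq_iff eq_commute)
  show "V i = V j" if "V (Suc i) = V (Suc j)"
    using * that by (metis nat_le_linear)
qed (simp add: V_eq_iff, metis mod_Suc_eq)

text \<open>Otherwise \<open>n\<close> would divide 2. Hence the two neighbours of a vertex are
  distinct.\<close>

lemma V_Suc_Suc_neq: "V (Suc (Suc i)) \<noteq> V i"
proof
  assume "V (Suc (Suc i)) = V i"
  then have "n dvd Suc (Suc i) - i" using V_eqE[of i "Suc (Suc i)"] by simp
  moreover have "Suc (Suc i) - i = 2" by simp
  ultimately show False using n_ge by (auto dest: dvd_imp_le)
qed

lemma V_bij: "bij_betw V {..<n} UNIV"
proof -
  have "V ` {..<n} = range V"
  proof -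
    have "V i = V (i mod n)" for i by (simp add: V_eq_iff)
    moreover have "i mod n < n" for i using n_ge by simp
    ultimately show ?thesis by (metis (no_types, lifting) UNIV_I UNIV_eq_I V_surj image_eqI lessThan_iff surj_def)
  qed
  then show ?thesis using V_surj by (auto simp: bij_betw_def inj_on_def V_eq_iff)
qed

lemma card_V: "CARD('v) = n"
  using bij_betw_same_card[OF V_bij] by simp

text \<open>Shifting by a full period supplies a predecessor. Vertexwise claims can then be checked
  at \<open>V (Suc i)\<close>, whose neighbours are \<open>V i\<close> and
  \<open>V (Suc (Suc i))\<close>, without subtracting indices.\<close>

lemma Suc_ex: "\<exists>i. v = V (Suc i)"
proof -
  obtain i where "v = V i" using V_surj by blast
  then have "v = V (Suc (i + n - 1))" using n_ge V_add_n[of i] by simp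
  then show ?thesis by blast
qed

lemma V_Suc_bij: "bij_betw (\<lambda>i. V (Suc i)) {..<n} UNIV"
proof -
  have "inj_on (\<lambda>i. V (Suc i)) {..<n}"
    using V_bij by (auto simp: bij_betw_def inj_on_def V_Suc_eq_iff)
  then have "card ((\<lambda>i. V (Suc i)) ` {..<n}) = CARD('v)"
    by (simp add: card_image card_V)
  then show ?thesis
    using \<open>inj_on _ _\<close> by (metis bij_betw_def card_subset_eq finite subset_UNIV)
qed

lemma edge_iff: "{V (Suc i), u} \<in> E \<longleftrightarrow> u = V i \<or> u = V (Suc (Suc i))"
proof
  assume "{V (Suc i), u} \<in> E"
  then obtain j where "{V (Suc i), u} = {V j, V (Suc j)}" using E_eq by blast
  then consider "V (Suc i) = V j" "u = V (Suc j)" | "V (Suc i) = V (Suc j)" "u = V j"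
    by (auto simp: doubleton_eq_iff)
  then show "u = V i \<or> u = V (Suc (Suc i))"
    by cases (metis V_Suc_eq_iff)+
next
  assume "u = V i \<or> u = V (Suc (Suc i))"
  then show "{V (Suc i), u} \<in> E"
    unfolding E_eq by (auto simp: insert_commute)
qed

lemma edge_bij: "bij_betw (\<lambda>i. {V i, V (Suc i)}) {..<n} E"
proof -
  \<comment> \<open>A crosswise match would give \<open>V (Suc (Suc i)) = V (Suc j) = V i\<close>,
    which is excluded.\<close>
  have "{V i, V (Suc i)} = {V j, V (Suc j)} \<Longrightarrow> V i = V j" for i j
    by (metis V_Suc_Suc_neq V_Suc_eq_iff doubleton_eq_iff)
  then have inj: "inj_on (\<lambda>i. {V i, V (Suc i)}) {..<n}"
    using V_bij by (auto simp: bij_betw_def inj_on_def)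
  have "{V i, V (Suc i)} \<in> (\<lambda>i. {V i, V (Suc i)}) ` {..<n}" for i
  proof -
    have "V i = V (i mod n)" by (simp add: V_eq_iff)
    moreover from this have "V (Suc i) = V (Suc (i mod n))" using V_Suc_eq_iff by blast
    moreover have "i mod n < n" using n_ge by simp
    ultimately show ?thesis by (metis (no_types, lifting) image_eqI lessThan_iff)
  qed
  then show ?thesis using inj by (auto simp: bij_betw_def E_eq)
qed

text \<open>At each of its vertices a cycle uses two distinct neighbours, and \<open>E\<close>
  offers only two. So \<open>ws\<close> contains the successor of each of its vertices and, going
  round, every vertex.\<close>

lemma cycle_length:
  assumes "cycle_in E ws"
  shows "length ws = n"
proof -
  define m where "m = length ws"
  define W where "W i = ws ! (i mod m)" for i
  have m: "3 \<le> m" and dist: "distinct ws" and sub: "cycle_edges ws \<subseteq> E"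
    using assms by (auto simp: cycle_in_def m_def)
  have lt: "i mod m < m" for i
    by (rule mod_less_divisor) (use m in linarith)
  have W_in: "W i \<in> set ws" for i using lt[of i] by (simp add: W_def m_def)
  have W_edge: "{W i, W (Suc i)} \<in> E" for i
  proof -
    have "{W i, W (Suc i)} \<in> cycle_edges ws"
      unfolding cycle_edges_def W_def using lt[of i]
      by (auto simp: m_def mod_Suc_eq intro!: exI[of _ "i mod length ws"])
    then show ?thesis using sub by blast
  qed
  have W_neq: "W (Suc (Suc i)) \<noteq> W i" for i
  proof
    assume "W (Suc (Suc i)) = W i"
    then have "Suc (Suc i) mod m = i mod m"
      using dist lt by (simp add: W_def m_def nth_eq_iff_index_eq)
    then have "m dvd Suc (Suc i) - i" by (metis mod_eq_dvd_iff_nat le_Suc_eq le_refl)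
    moreover have "Suc (Suc i) - i = 2" by simp
    ultimately show False using m by (auto dest: dvd_imp_le)
  qed
  have step: "V (Suc (Suc i)) \<in> set ws" if "V (Suc i) \<in> set ws" for i
  proof -
    obtain j where j: "j < m" "V (Suc i) = ws ! j"
      using \<open>V (Suc i) \<in> set ws\<close> by (metis in_set_conv_nth m_def)
    \<comment> \<open>Modulo \<open>m\<close>, the index \<open>j + m - 1\<close> is the predecessor
      of \<open>j\<close>; adding \<open>m\<close> avoids truncation at
      \<open>j = 0\<close>.\<close>
    then have W_j: "V (Suc i) = W (Suc (j + m - 1))" using m by (simp add: W_def)
    define k where "k = j + m - 1"
    have "{V (Suc i), W k} \<in> E" "{V (Suc i), W (Suc (Suc k))} \<in> E"
      using W_edge[of k] W_edge[of "Suc k"] W_j by (simp_all add: k_def insert_commute)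
    then have "V (Suc (Suc i)) = W k \<or> V (Suc (Suc i)) = W (Suc (Suc k))"
      using W_neq[of k] edge_iff by metis
    then show ?thesis using W_in by auto
  qed
  obtain k where k: "W 0 = V (Suc k)" using Suc_ex by blast
  have reach: "V (Suc (k + i)) \<in> set ws" for i
    by (induction i) (use k W_in[of 0] step in auto)
  have "v \<in> set ws" for v
  proof -
    obtain i where "v = V i" using V_surj by blast
    \<comment> \<open>Adding enough periods moves the index past the starting point
      \<open>Suc k\<close>, so that \<open>v\<close> is reached by forward steps alone.\<close>
    then have "v = V (i + Suc k * n)" by (simp add: V_eq_iff del: mult_Suc)
    moreover have "\<exists>d. i + Suc k * n = Suc (k + d)"
    proof -
      have "Suc k * 1 \<le> Suc k * n" using n_ge by (intro mult_le_mono) auto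
      then show ?thesis by (metis add.commute add_Suc le_add2 le_iff_add le_trans mult.right_neutral)
    qed
    ultimately show ?thesis using reach by metis
  qed
  then have "set ws = UNIV" by blast
  then show ?thesis using distinct_card[OF dist] card_V by simp
qed

end

section \<open>Existence of an enumeration and the girth\<close>

lemma cycle_enumeration_exists:
  fixes E :: "'v::finite set set"
  assumes "cycle_graph E"
  obtains V where "cycle_enumeration E V CARD('v)"
proof -
  obtain vs where vs: "3 \<le> length vs" "distinct vs" "set vs = UNIV" "E = cycle_edges vs"
    using assms by (auto simp: cycle_graph_def)
  have len: "CARD('v) = length vs" using vs distinct_card by metis
  have lt: "i mod length vs < length vs" for i
    by (rule mod_less_divisor) (use vs(1) in linarith)
  define V where "V i = vs ! (i mod length vs)" for i
  have "cycle_enumeration E V (length vs)"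
  proof
    show "V i = V j \<longleftrightarrow> i mod length vs = j mod length vs" for i j
      using vs(2) lt by (simp add: V_def nth_eq_iff_index_eq)
    have "\<exists>i. v = V i" for v
    proof -
      have "v \<in> set vs" using vs by simp
      then show ?thesis unfolding V_def by (metis in_set_conv_nth mod_less)
    qed
    then show "surj V" by (metis surjI)
    show "E = range (\<lambda>i. {V i, V (Suc i)})"
    proof (intro set_eqI iffI)
      fix e assume "e \<in> E"
      then obtain i where "i < length vs" "e = {vs ! i, vs ! (Suc i mod length vs)}"
        using vs by (auto simp: cycle_edges_def)
      then have "e = {V i, V (Suc i)}" by (simp add: V_def)
      then show "e \<in> range (\<lambda>i. {V i, V (Suc i)})" by blast
    next
      fix e assume "e \<in> range (\<lambda>i. {V i, V (Suc i)})"
      then obtain i where "e = {V i, V (Suc i)}" by blast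
      then show "e \<in> E" unfolding V_def vs(4) cycle_edges_def using lt[of i]
        by (auto simp: mod_Suc_eq intro!: exI[of _ "i mod length vs"])
    qed
  qed (use vs in simp)
  then show ?thesis using that len by metis
qed

lemma girth_cycle_graph:
  fixes E :: "'v::finite set set"
  assumes "cycle_graph E"
  shows "girth E = CARD('v)"
proof -
  obtain V where "cycle_enumeration E V CARD('v)"
    using cycle_enumeration_exists[OF assms] .
  then interpret cycle_enumeration E V "CARD('v)" .
  obtain vs where "3 \<le> length vs" "distinct vs" "E = cycle_edges vs"
    using assms by (auto simp: cycle_graph_def)
  then have vs: "cycle_in E vs" by (simp add: cycle_in_def)
  \<comment> \<open>The defining list \<open>vs\<close> is itself a cycle, so the infimum is not
    over the empty set.\<close>
  have "{length ws | ws. cycle_in E ws} = {CARD('v)}"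
    using cycle_length vs by force
  then show ?thesis by (simp add: girth_def)
qed

section \<open>Signs, eigenspaces and the signed rotation\<close>

locale signed_cycle_enumeration = cycle_enumeration E V n
  for E :: "'v::finite set set" and V n +
  fixes \<sigma> :: "'v set \<Rightarrow> int"
  assumes sign: "e \<in> E \<Longrightarrow> \<sigma> e = 1 \<or> \<sigma> e = -1"
begin

definition S :: "nat \<Rightarrow> real" where
  "S i = of_int (\<sigma> {V i, V (Suc i)})"

lemma S_sq: "S i * S i = 1"
proof -
  have "{V i, V (Suc i)} \<in> E" by (auto simp: E_eq)
  then show ?thesis using sign by (fastforce simp: S_def)
qed

lemma S_mult_S_mult: "S i * (S i * a) = a"
  by (metis S_sq mult.assoc mult_1_left)

lemma S_cong: "V i = V j \<Longrightarrow> S i = S j"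
  using V_Suc_eq_iff by (metis S_def)

lemma prod_S: "(\<Prod>i<n. S i) = of_int (\<Prod>e\<in>E. \<sigma> e)"
  using prod.reindex_bij_betw[OF edge_bij, of \<sigma>] by (simp add: S_def flip: of_int_prod)

lemma vec_eqI:
  fixes x y :: "real ^ 'v"
  shows "(\<And>i. x $ V (Suc i) = y $ V (Suc i)) \<Longrightarrow> x = y"
  using Suc_ex by (metis vec_eq_iff)

lemma adj_matrix_mult:
  "(adj_matrix E \<sigma> *v x) $ V (Suc i) = S i * x $ V i + S (Suc i) * x $ V (Suc (Suc i))"
proof -
  have "(adj_matrix E \<sigma> *v x) $ V (Suc i) =
      (\<Sum>u\<in>UNIV. if u \<in> {V i, V (Suc (Suc i))} then of_int (\<sigma> {V (Suc i), u}) * x $ u else 0)"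
    unfolding matrix_vector_mult_def adj_matrix_def by (auto simp: edge_iff intro!: sum.cong)
  also have "\<dots> = (\<Sum>u\<in>{V i, V (Suc (Suc i))}. of_int (\<sigma> {V (Suc i), u}) * x $ u)"
    by (subst sum.inter_restrict[symmetric]) auto
  also have "\<dots> = S i * x $ V i + S (Suc i) * x $ V (Suc (Suc i))"
    using V_Suc_Suc_neq[of i] by (simp add: S_def insert_commute)
  finally show ?thesis .
qed

definition eigenspace :: "real \<Rightarrow> (real ^ 'v) set" where
  "eigenspace \<mu> = {x. (\<mu> *\<^sub>R mat 1 - adj_matrix E \<sigma>) *v x = 0}"

lemma eigenspace_iff:
  "x \<in> eigenspace \<mu> \<longleftrightarrow>
    (\<forall>i. \<mu> * x $ V (Suc i) = S i * x $ V i + S (Suc i) * x $ V (Suc (Suc i)))"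
proof -
  have "(\<mu> *\<^sub>R mat 1 - adj_matrix E \<sigma>) *v x = \<mu> *\<^sub>R x - adj_matrix E \<sigma> *v x"
    by (simp add: matrix_vector_mult_diff_rdistrib scaleR_matrix_vector_assoc[symmetric])
  then have "x \<in> eigenspace \<mu> \<longleftrightarrow> \<mu> *\<^sub>R x = adj_matrix E \<sigma> *v x"
    by (simp add: eigenspace_def)
  also have "\<dots> \<longleftrightarrow> (\<forall>i. (\<mu> *\<^sub>R x) $ V (Suc i) = (adj_matrix E \<sigma> *v x) $ V (Suc i))"
    using vec_eqI by metis
  finally show ?thesis by (simp add: adj_matrix_mult)
qed

lemma subspace_eigenspace: "subspace (eigenspace \<mu>)"
  by (auto simp: eigenspace_iff subspace_def algebra_simps)

lemma eig_mult_eq_dim: "eig_mult E \<sigma> \<mu> = dim (eigenspace \<mu>)"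
  by (simp add: eig_mult_def eigenspace_def dim_null_space)

text \<open>This is the rotation \<open>P\<close>. Vectors are indexed by vertices, so an index has
  to be chosen; by \<open>S_cong\<close> and \<open>V_Suc_eq_iff\<close> the choice does not
  matter.\<close>

definition shift :: "real ^ 'v \<Rightarrow> real ^ 'v" where
  "shift x = (\<chi> v. let i = SOME i. V i = v in S i * x $ V (Suc i))"

lemma shift_nth: "shift x $ V i = S i * x $ V (Suc i)"
proof -
  define j where "j = (SOME j. V j = V i)"
  have "V j = V i" unfolding j_def by (rule someI) (rule refl)
  then have "S j = S i" "V (Suc j) = V (Suc i)" by (rule S_cong, simp only: V_Suc_eq_iff)
  then show ?thesis by (simp add: shift_def Let_def flip: j_def)
qed

text \<open>The rotation commutes with the adjacency matrix.\<close>

lemma shift_eigenspace: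
  assumes "x \<in> eigenspace \<mu>"
  shows "shift x \<in> eigenspace \<mu>"
  unfolding eigenspace_iff
proof
  fix i
  have "\<mu> * shift x $ V (Suc i) = S (Suc i) * (\<mu> * x $ V (Suc (Suc i)))"
    by (simp add: shift_nth)
  also have "\<mu> * x $ V (Suc (Suc i))
      = S (Suc i) * x $ V (Suc i) + S (Suc (Suc i)) * x $ V (Suc (Suc (Suc i)))"
    using assms by (simp add: eigenspace_iff)
  also have "S (Suc i) * (S (Suc i) * x $ V (Suc i) + S (Suc (Suc i)) * x $ V (Suc (Suc (Suc i))))
    = (S (Suc i) * S (Suc i)) * x $ V (Suc i) + S (Suc i) * shift x $ V (Suc (Suc i))"
    by (simp add: shift_nth algebra_simps)
  \<comment> \<open>Both squares equal 1; exchanging them produces the factor \<open>S i\<close>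
    needed for \<open>shift x $ V i\<close>.\<close>
  also have "\<dots> = (S i * S i) * x $ V (Suc i) + S (Suc i) * shift x $ V (Suc (Suc i))"
    by (simp add: S_sq)
  also have "\<dots> = S i * shift x $ V i + S (Suc i) * shift x $ V (Suc (Suc i))"
    by (simp add: shift_nth)
  finally show "\<mu> * shift x $ V (Suc i)
    = S i * shift x $ V i + S (Suc i) * shift x $ V (Suc (Suc i))" .
qed

section \<open>Eigenvectors of the rotation and one-dimensional eigenspaces\<close>

lemma sum_V_Suc:
  fixes f :: "'v \<Rightarrow> real"
  shows "(\<Sum>i<n. f (V (Suc i))) = (\<Sum>i<n. f (V i))"
  using sum.reindex_bij_betw[OF V_bij, of f] sum.reindex_bij_betw[OF V_Suc_bij, of f] by simp

lemma sum_V_sq_eq_0: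
  fixes x :: "real ^ 'v"
  assumes "(\<Sum>i<n. (x $ V i)\<^sup>2) = 0"
  shows "x = 0"
  using sum.reindex_bij_betw[OF V_bij, of "\<lambda>v. (x $ v)\<^sup>2"] assms
  by (simp add: sum_nonneg_eq_0_iff vec_eq_iff)

text \<open>Each \<open>S i\<close> is its own inverse, so the relation is a first-order recurrence
  that determines \<open>x\<close> from \<open>x $ V 0\<close>.\<close>

lemma shift_eigenvector_nth:
  assumes "\<And>i. S i * x $ V (Suc i) = c * x $ V i"
  shows "x $ V i = c ^ i * (\<Prod>j<i. S j) * x $ V 0"
proof (induction i)
  case (Suc i)
  have "x $ V (Suc i) = S i * (S i * x $ V (Suc i))" by (simp only: S_mult_S_mult)
  also have "\<dots> = S i * (c * (c ^ i * (\<Prod>j<i. S j) * x $ V 0))" by (simp only: assms Suc)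
  finally show ?case by simp
qed simp

text \<open>The rotation preserves the norm, which gives \<open>c\<^sup>2 = 1\<close>; the
  eigenvalue equation at a nonzero entry gives \<mu>; one full turn gives the condition on the
  signs.\<close>

lemma shift_eigenvalue:
  assumes "x \<noteq> 0" "x \<in> eigenspace \<mu>" "shift x = c *\<^sub>R x"
  shows "c\<^sup>2 = 1 \<and> \<mu> = 2 * c \<and> c ^ n * (\<Prod>i<n. S i) = 1"
proof -
  have sh: "S i * x $ V (Suc i) = c * x $ V i" for i
    using assms(3) by (metis shift_nth vector_scaleR_component real_scaleR_def)
  have sh': "x $ V (Suc i) = c * S i * x $ V i" for i
  proof -
    have "x $ V (Suc i) = S i * (S i * x $ V (Suc i))" by (simp only: S_mult_S_mult)
    then show ?thesis by (simp only: sh mult.assoc mult.left_commute)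
  qed
  have "(\<Sum>i<n. (x $ V i)\<^sup>2) = (\<Sum>i<n. (x $ V (Suc i))\<^sup>2)"
    using sum_V_Suc[of "\<lambda>v. (x $ v)\<^sup>2"] by simp
  also have "\<dots> = (\<Sum>i<n. c\<^sup>2 * (x $ V i)\<^sup>2)"
    using S_sq by (simp add: sh' power_mult_distrib power2_eq_square[of "S _"])
  also have "\<dots> = c\<^sup>2 * (\<Sum>i<n. (x $ V i)\<^sup>2)" by (simp add: sum_distrib_left)
  finally have c: "c\<^sup>2 = 1" using sum_V_sq_eq_0[of x] assms(1) by auto
  obtain i where i: "x $ V (Suc i) \<noteq> 0" using vec_eqI[of x 0] assms(1) by auto
  have "\<mu> * x $ V (Suc i) = S i * x $ V i + S (Suc i) * x $ V (Suc (Suc i))"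
    using assms(2) by (simp add: eigenspace_iff)
  \<comment> \<open>As \<open>c\<close> is its own inverse, the inverse rotation acts by
    \<open>c\<close> as well.\<close>
  also have "S i * x $ V i = c * x $ V (Suc i)"
  proof -
    have "c * x $ V (Suc i) = c\<^sup>2 * (S i * x $ V i)"
      by (simp only: sh' power2_eq_square mult.assoc)
    then show ?thesis using c by simp
  qed
  finally have mu: "\<mu> = 2 * c" using sh[of "Suc i"] i by simp
  note nth = shift_eigenvector_nth[OF sh]
  have "x $ V 0 \<noteq> 0" using i nth by (metis mult_zero_right)
  moreover have "x $ V n = x $ V 0" using V_add_n[of 0] by simp
  ultimately show ?thesis using c mu nth[of n] by simp
qed

text \<open>The squared norm of \<open>shift x - c *\<^sub>R x\<close> is expanded and shown to
  vanish.\<close>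

lemma eigenspace_shift_eigenvector:
  assumes c: "c\<^sup>2 = 1" and x: "x \<in> eigenspace (2 * c)"
  shows "S i * x $ V (Suc i) = c * x $ V i"
proof -
  define y where "y = shift x - c *\<^sub>R x"
  have ynth: "y $ V i = S i * x $ V (Suc i) - c * x $ V i" for i
    by (simp add: y_def shift_nth)
  let ?q = "\<lambda>v. (x $ v)\<^sup>2"
  let ?p = "\<lambda>v. x $ v * shift x $ v"
  have "(\<Sum>i<n. (y $ V i)\<^sup>2) = (\<Sum>i<n. ?q (V (Suc i)) + ?q (V i) - 2 * c * ?p (V i))"
  proof (rule sum.cong)
    fix i
    have "(y $ V i)\<^sup>2 = (S i * S i) * ?q (V (Suc i)) + c\<^sup>2 * ?q (V i) - 2 * c * ?p (V i)"
      by (simp add: ynth shift_nth power2_eq_square algebra_simps)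
    then show "(y $ V i)\<^sup>2 = ?q (V (Suc i)) + ?q (V i) - 2 * c * ?p (V i)"
      using c S_sq by simp
  qed simp
  also have "\<dots> = 2 * (\<Sum>i<n. ?q (V (Suc i))) - 2 * c * (\<Sum>i<n. ?p (V i))"
    using sum_V_Suc[of ?q] by (simp add: sum.distrib sum_subtractf sum_distrib_left)
  \<comment> \<open>The cross term is split into two copies, one moved a step ahead. Paired at
    \<open>V (Suc i)\<close>, they form \<open>x $ V (Suc i)\<close> times the right side of the
    eigenvalue equation.\<close>
  also have "2 * c * (\<Sum>i<n. ?p (V i)) = c * ((\<Sum>i<n. ?p (V i)) + (\<Sum>i<n. ?p (V (Suc i))))"
    using sum_V_Suc[of ?p] by simp
  also have "(\<Sum>i<n. ?p (V i)) + (\<Sum>i<n. ?p (V (Suc i))) = (\<Sum>i<n. 2 * c * ?q (V (Suc i)))"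
    unfolding sum.distrib[symmetric]
  proof (rule sum.cong)
    fix i
    have "2 * c * x $ V (Suc i) = S i * x $ V i + S (Suc i) * x $ V (Suc (Suc i))"
      using x by (simp add: eigenspace_iff)
    then have "x $ V (Suc i) * (2 * c * x $ V (Suc i))
        = x $ V (Suc i) * (S i * x $ V i + S (Suc i) * x $ V (Suc (Suc i)))" by simp
    then show "?p (V i) + ?p (V (Suc i)) = 2 * c * ?q (V (Suc i))"
      by (simp add: shift_nth power2_eq_square algebra_simps)
  qed simp
  also have "c * \<dots> = 2 * c\<^sup>2 * (\<Sum>i<n. ?q (V (Suc i)))"
    by (simp add: sum_distrib_left power2_eq_square algebra_simps)
  finally have "y = 0" using c by (intro sum_V_sq_eq_0) simp
  then show ?thesis using ynth[of i] by simp
qed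

text \<open>The recurrence is solved explicitly from the value 1 at \<open>V 0\<close>;
  \<open>eps\<close> says that the solution closes up after one turn.\<close>

lemma eigenspace_nonzero:
  assumes c: "c\<^sup>2 = 1" and eps: "c ^ n * (\<Prod>i<n. S i) = 1"
  obtains w where "w \<noteq> 0" "w \<in> eigenspace (2 * c)"
proof -
  define f where "f i = c ^ i * (\<Prod>j<i. S j)" for i
  \<comment> \<open>\<open>inv_into\<close> picks the index below \<open>n\<close>, so the
    recurrence needs a separate check only on the edge from \<open>V (n - 1)\<close> back to
    \<open>V 0\<close>.\<close>
  define w where "w = (\<chi> v. f (inv_into {..<n} V v))"
  have w: "w $ V i = f i" if "i < n" for i
    using V_bij that by (simp add: w_def bij_betw_def)
  have step: "S i * w $ V (Suc i) = c * w $ V i" if "i < n" for i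
  proof -
    have "w $ V (Suc i) = f (Suc i)"
    proof (cases "Suc i = n")
      case True
      have "w $ V n = w $ V 0" using V_add_n[of 0] by simp
      also have "\<dots> = f n" using w[of 0] n_ge eps by (simp add: f_def)
      finally show ?thesis using True by simp
    qed (use w that in simp)
    moreover have "S i * f (Suc i) = (S i * S i) * (c * f i)" by (simp add: f_def algebra_simps)
    ultimately show ?thesis using w[OF that] S_sq by simp
  qed
  have all: "S i * w $ V (Suc i) = c * w $ V i" for i
  proof -
    have e: "V i = V (i mod n)" by (simp add: V_eq_iff)
    then have "V (Suc i) = V (Suc (i mod n))" "S i = S (i mod n)"
      using V_Suc_eq_iff S_cong by blast+
    with e step[of "i mod n"] n_ge show ?thesis by simp
  qed
  have "S i * w $ V i = c * w $ V (Suc i)" for i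
  proof -
    have "w $ V (Suc i) = S i * (S i * w $ V (Suc i))" by (simp only: S_mult_S_mult)
    then have "w $ V (Suc i) = S i * (c * w $ V i)" by (simp only: all)
    then have "c * w $ V (Suc i) = c\<^sup>2 * (S i * w $ V i)"
      by (simp add: power2_eq_square algebra_simps)
    then show ?thesis using c by simp
  qed
  then have "w \<in> eigenspace (2 * c)" by (simp add: eigenspace_iff all)
  moreover have "w $ V 0 = 1" using w[of 0] n_ge by (simp add: f_def)
  then have "w \<noteq> 0" by auto
  ultimately show ?thesis using that by blast
qed

lemma dim_eigenspace_eq_1_iff:
  "dim (eigenspace \<mu>) = 1 \<longleftrightarrow>
    (\<exists>c. c\<^sup>2 = 1 \<and> \<mu> = 2 * c \<and> c ^ n * of_int (\<Prod>e\<in>E. \<sigma> e) = 1)"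
proof
  assume "dim (eigenspace \<mu>) = 1"
  then obtain w where w: "w \<noteq> 0" "eigenspace \<mu> = span {w}"
    using dim_1_imp_span_singleton subspace_eigenspace by blast
  then have "w \<in> eigenspace \<mu>" by (simp add: span_base)
  \<comment> \<open>The rotation maps the line spanned by \<open>w\<close> into itself, so
    \<open>w\<close> is an eigenvector of it with a real eigenvalue.\<close>
  moreover from shift_eigenspace[OF this] obtain c where "shift w = c *\<^sub>R w"
    using w by (auto simp: span_singleton)
  ultimately show "\<exists>c. c\<^sup>2 = 1 \<and> \<mu> = 2 * c \<and> c ^ n * of_int (\<Prod>e\<in>E. \<sigma> e) = 1"
    using shift_eigenvalue[OF w(1)] prod_S by auto
next
  assume "\<exists>c. c\<^sup>2 = 1 \<and> \<mu> = 2 * c \<and> c ^ n * of_int (\<Prod>e\<in>E. \<sigma> e) = 1"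
  then obtain c :: real
    where c: "c\<^sup>2 = 1" "\<mu> = 2 * c" "c ^ n * (\<Prod>i<n. S i) = 1"
    by (auto simp: prod_S)
  obtain w where w: "w \<noteq> 0" "w \<in> eigenspace \<mu>"
    using eigenspace_nonzero[OF c(1,3)] c(2) by blast
  have nth: "x $ V i = c ^ i * (\<Prod>j<i. S j) * x $ V 0" if "x \<in> eigenspace \<mu>" for x i
    using shift_eigenvector_nth eigenspace_shift_eigenvector[OF c(1)] that c(2) by blast
  have w0: "w $ V 0 \<noteq> 0"
  proof
    assume "w $ V 0 = 0"
    then have "w $ V i = 0" for i using nth[OF w(2), of i] by simp
    then have "w = 0" by (intro vec_eqI) simp
    then show False using w(1) by simp
  qed
  have "x \<in> span {w}" if "x \<in> eigenspace \<mu>" for x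
  proof -
    \<comment> \<open>Both sides satisfy the same recurrence and agree at
      \<open>V 0\<close>.\<close>
    have "x = (x $ V 0 / w $ V 0) *\<^sub>R w"
    proof (rule vec_eqI)
      fix i
      show "x $ V (Suc i) = ((x $ V 0 / w $ V 0) *\<^sub>R w) $ V (Suc i)"
        using w0 nth[OF that, of "Suc i"] nth[OF w(2), of "Suc i"] by simp
    qed
    then show ?thesis by (metis span_base span_mul singletonI)
  qed
  then have "eigenspace \<mu> = span {w}"
    using w(2) subspace_eigenspace by (simp add: span_minimal subsetI subset_antisym)
  then show "dim (eigenspace \<mu>) = 1"
    using w(1) by (simp add: dim_span_eq_card_independent)
qed

end

theorem theorem4:
  fixes E :: "'v::finite set set"
    and \<sigma> :: "'v set \<Rightarrow> int"
    and n :: nat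
    and \<mu> :: real
  assumes "n = CARD('v)"
    and "3 \<le> n"
    and "signed_cycle E \<sigma>"
  shows "girth E = n \<and>
    (int (eig_mult E \<sigma> \<mu>) = int n - int (girth E) + 1 \<longleftrightarrow>
       balanced_cycle E \<sigma> \<and> \<mu> = 2 \<or>
       balanced_cycle E \<sigma> \<and> even n \<and> \<mu> = -2 \<or>
       unbalanced_cycle E \<sigma> \<and> odd n \<and> \<mu> = -2)"
proof -
  have cyc: "cycle_graph E" and sign: "\<And>e. e \<in> E \<Longrightarrow> \<sigma> e = 1 \<or> \<sigma> e = -1"
    using assms(3) by (auto simp: signed_cycle_def signed_graph_def)
  obtain V where "cycle_enumeration E V CARD('v)"
    using cycle_enumeration_exists[OF cyc] .
  then interpret signed_cycle_enumeration E V n \<sigma>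
    using sign assms(1) by (simp add: signed_cycle_enumeration_def signed_cycle_enumeration_axioms_def)
  have girth: "girth E = n" using girth_cycle_graph[OF cyc] assms(1) by simp
  define \<epsilon> where "\<epsilon> = (\<Prod>e\<in>E. \<sigma> e)"
  have "\<bar>\<epsilon>\<bar> = (\<Prod>e\<in>E. \<bar>\<sigma> e\<bar>)" by (simp add: \<epsilon>_def abs_prod)
  also have "\<dots> = 1" by (rule prod.neutral) (use sign in fastforce)
  finally have eps: "\<epsilon> = 1 \<or> \<epsilon> = -1" by linarith
  \<comment> \<open>Since the girth is \<open>n\<close>, the prescribed multiplicity is 1.\<close>
  have "int (eig_mult E \<sigma> \<mu>) = int n - int (girth E) + 1 \<longleftrightarrow> dim (eigenspace \<mu>) = 1"
    using girth eig_mult_eq_dim by simp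
  also have "\<dots> \<longleftrightarrow> (\<exists>c. c\<^sup>2 = 1 \<and> \<mu> = 2 * c \<and> c ^ n * of_int \<epsilon> = 1)"
    unfolding \<epsilon>_def by (rule dim_eigenspace_eq_1_iff)
  \<comment> \<open>The two alternatives are \<open>c = 1\<close> and \<open>c = -1\<close>; in the
    second, the parity of \<open>n\<close> decides which sign product is required.\<close>
  also have "\<dots> \<longleftrightarrow> \<mu> = 2 \<and> \<epsilon> = 1 \<or> \<mu> = -2 \<and> (- 1) ^ n * real_of_int \<epsilon> = 1"
    by (auto simp: power2_eq_1_iff)
  also have "\<dots> \<longleftrightarrow> \<mu> = 2 \<and> \<epsilon> = 1 \<or> \<mu> = -2 \<and> even n \<and> \<epsilon> = 1 \<or> \<mu> = -2 \<and> odd n \<and> \<epsilon> \<noteq> 1"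
    using eps by (cases "even n") auto
  finally show ?thesis
    using girth assms(3) by (auto simp: balanced_cycle_def unbalanced_cycle_def \<epsilon>_def)
qed

end
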